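(* Let $k$ be a positive integer, let $A,B$ be non-zero real constants, and consider the equation $$u_{n+4k}=\frac{u_n}{A+B\prod_{i=1}^{k}u_{n+4(i-1)}},\qquad n\ge 0.$$ Assume $A\neq 1$. The zero equilibrium point $\bar u=0$ is asymptotically stable for $|A|>1$ and unstable for $|A|<1$. Furthermore, all non-zero equilibrium points of the equation are non-hyperbolic.
   Context: Write the equation as $u_{n+4k}=f(u_n,u_{n+4},\dots,u_{n+4k-4})$. An equilibrium point is a number $\bar u$ with $\bar u=f(\bar u,\dots,\bar u)$. Put $p_i=\frac{\partial f}{\partial u_{n+i}}(\bar u,\dots,\bar u)$ for $i=4r$, $r=0,1,\dots,k-1$. The characteristic equation about $\bar u$ is $$\lambda^{4k}-p_{4k-4}\lambda^{4k-4}-\dots-p_4\lambda^4-p_0=0.$$ The equilibrium point $\bar u$ is called non-hyperbolic if this equation has a (complex) root of absolute value equal to one. The equilibrium point $\bar u$ is locally stable if for every $\epsilon>0$ there is $\delta>0$ such that every solution $(u_n)_{n\ge0}$ with $|u_0-\bar u|+\dots+|u_{4k-1}-\bar u|<\delta$ satisfies $|u_n-\bar u|<\epsilon$ for all $n\ge0$; it is unstable if it is not locally stable. Asymptotically stable is meant in the local sense: $\bar u$ is locally stable and every solution with initial values sufficiently close to $\bar u$ converges to $\bar u$.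
   Formalization: The claim that all non-zero equilibrium points are non-hyperbolic is proved only for k ≥ 2 or |A| = 1; it is false for k = 1 with |A| ≠ 1, where the only non-zero equilibrium (1−A)/B has characteristic equation λ^4 = A. *)

theory Defs
  imports "HOL-Analysis.Analysis"
begin

text \<open>
  A difference equation \<open>u (n + 4k) = f (u n, u (n + 4), ..., u (n + 4k - 4))\<close> over the reals is
  given by \<open>k\<close>, the function \<open>f\<close> and the set \<open>D\<close> on which \<open>f\<close> is defined. The argument tuple of
  length \<open>k\<close> is a function \<open>w :: nat \<Rightarrow> real\<close> whose entry \<open>w r\<close> is \<open>u (n + 4r)\<close>; only the entries
  with \<open>r < k\<close> are meant to matter. The set \<open>D\<close> is explicit because HOL division is total
  (\<open>x / 0 = 0\<close>): a solution is a sequence for which every step is actually defined.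
\<close>

definition is_solution ::
    "nat \<Rightarrow> (nat \<Rightarrow> real) set \<Rightarrow> ((nat \<Rightarrow> real) \<Rightarrow> real) \<Rightarrow> (nat \<Rightarrow> real) \<Rightarrow> bool" where
  "is_solution k D f u \<longleftrightarrow>
     (\<forall>n. (\<lambda>r. u (n + 4 * r)) \<in> D \<and> u (n + 4 * k) = f (\<lambda>r. u (n + 4 * r)))"

definition is_equilibrium ::
    "(nat \<Rightarrow> real) set \<Rightarrow> ((nat \<Rightarrow> real) \<Rightarrow> real) \<Rightarrow> real \<Rightarrow> bool" where
  "is_equilibrium D f ubar \<longleftrightarrow> (\<lambda>_. ubar) \<in> D \<and> ubar = f (\<lambda>_. ubar)"

definition locally_stable ::
    "nat \<Rightarrow> (nat \<Rightarrow> real) set \<Rightarrow> ((nat \<Rightarrow> real) \<Rightarrow> real) \<Rightarrow> real \<Rightarrow> bool" where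
  "locally_stable k D f ubar \<longleftrightarrow>
     (\<forall>\<epsilon>>0. \<exists>\<delta>>0. \<forall>u. is_solution k D f u \<longrightarrow> (\<Sum>j<4 * k. \<bar>u j - ubar\<bar>) < \<delta> \<longrightarrow>
        (\<forall>n. \<bar>u n - ubar\<bar> < \<epsilon>))"

definition unstable ::
    "nat \<Rightarrow> (nat \<Rightarrow> real) set \<Rightarrow> ((nat \<Rightarrow> real) \<Rightarrow> real) \<Rightarrow> real \<Rightarrow> bool" where
  "unstable k D f ubar \<longleftrightarrow> \<not> locally_stable k D f ubar"

definition asymptotically_stable ::
    "nat \<Rightarrow> (nat \<Rightarrow> real) set \<Rightarrow> ((nat \<Rightarrow> real) \<Rightarrow> real) \<Rightarrow> real \<Rightarrow> bool" where
  "asymptotically_stable k D f ubar \<longleftrightarrow>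
     locally_stable k D f ubar \<and>
     (\<exists>\<gamma>>0. \<forall>u. is_solution k D f u \<longrightarrow> (\<Sum>j<4 * k. \<bar>u j - ubar\<bar>) < \<gamma> \<longrightarrow>
        u \<longlonglongrightarrow> ubar)"

text \<open>
  The coefficient \<open>p\<close> with index \<open>4r\<close>: the partial derivative of \<open>f\<close> with respect to
  \<open>u (n + 4r)\<close>, that is, with respect to entry \<open>r\<close> of the argument tuple.
\<close>

definition lin_coeff :: "((nat \<Rightarrow> real) \<Rightarrow> real) \<Rightarrow> real \<Rightarrow> nat \<Rightarrow> real" where
  "lin_coeff f ubar r = deriv (\<lambda>x. f ((\<lambda>_. ubar)(r := x))) ubar"

definition non_hyperbolic :: "nat \<Rightarrow> ((nat \<Rightarrow> real) \<Rightarrow> real) \<Rightarrow> real \<Rightarrow> bool" where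
  "non_hyperbolic k f ubar \<longleftrightarrow>
     (\<exists>z::complex. z ^ (4 * k) - (\<Sum>r<k. of_real (lin_coeff f ubar r) * z ^ (4 * r)) = 0 \<and>
        cmod z = 1)"

definition denom :: "nat \<Rightarrow> real \<Rightarrow> real \<Rightarrow> (nat \<Rightarrow> real) \<Rightarrow> real" where
  "denom k A B w = A + B * (\<Prod>i=1..k. w (i - 1))"

definition rhs :: "nat \<Rightarrow> real \<Rightarrow> real \<Rightarrow> (nat \<Rightarrow> real) \<Rightarrow> real" where
  "rhs k A B w = w 0 / denom k A B w"

definition rhs_dom :: "nat \<Rightarrow> real \<Rightarrow> real \<Rightarrow> (nat \<Rightarrow> real) set" where
  "rhs_dom k A B = {w. denom k A B w \<noteq> 0}"

end

theory Submission
  imports Defs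
begin

text \<open>
  Each of the three claims has its own reason.

  \<^item> Stability for \<open>\<bar>A\<bar> > 1\<close>. While the window \<open>u n, u (n + 4), \<dots>\<close> is small, the product is
    small too, so the denominator stays above some \<open>q > 1\<close> in absolute value and each step
    of length \<open>4k\<close> contracts by \<open>1 / q\<close>. Smallness of the window thereby reproduces itself, and
    solutions that start small decay geometrically (\<open>geometric_decay\<close>).

  \<^item> Instability for \<open>\<bar>A\<bar> < 1\<close>. It suffices to watch solutions supported on the multiples of
    \<open>4k\<close>. For \<open>k \<ge> 2\<close> each window of such a solution contains a zero, so the equation is the
    linear one \<open>u (n + 4k) = u n / A\<close>; for \<open>k = 1\<close> it is the Riccati equation
    \<open>u (n + 4) = u n / (A + B * u n)\<close>. In both cases the reciprocals obey an affine recurrence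
    \<open>v' = A * v + c\<close>, so they are \<open>b + A ^ m * t\<close> with fixed point \<open>b\<close>
    (\<open>reciprocal_solution\<close>). They approach \<open>b\<close> from an arbitrarily large start, hence \<open>u\<close>
    starts arbitrarily close to \<open>0\<close> and eventually exceeds a fixed bound. The division is
    defined at every step as long as no reciprocal vanishes, which excludes only countably many
    values of \<open>t\<close>.

  \<^item> Non-hyperbolicity. At an equilibrium \<open>ubar \<noteq> 0\<close> the denominator is \<open>1\<close>, which means
    \<open>B * ubar ^ k = 1 - A\<close>, and the linearization has coefficients \<open>A, A - 1, \<dots>, A - 1\<close>. With
    \<open>\<mu> = z ^ 4\<close> the characteristic polynomial factors as
    \<open>(\<mu> - A) * (1 + \<mu> + \<dots> + \<mu> ^ (k - 1))\<close> (\<open>characteristic_factorization\<close>). For \<open>k \<ge> 2\<close> the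
    second factor vanishes at every nontrivial \<open>k\<close>-th root of unity; for \<open>k = 1\<close> the only root is
    \<open>\<mu> = A\<close>, which is on the unit circle exactly when \<open>\<bar>A\<bar> = 1\<close>.
\<close>

section \<open>Stability of the zero equilibrium\<close>

lemma denom_eq_prod_lessThan: "denom k A B w = A + B * (\<Prod>r<k. w r)"
proof -
  have "(\<Prod>i=1..k. w (i - 1)) = (\<Prod>r<k. w r)"
    by (rule prod.reindex_bij_witness[of _ Suc "\<lambda>i. i - 1"]) auto
  then show ?thesis by (simp add: denom_def)
qed

text \<open>
  The bound \<open>\<bar>B\<bar> * \<eta> \<le> \<bar>A\<bar> - q\<close> together with \<open>\<eta> \<le> 1\<close> makes the product term at most
  \<open>\<bar>A\<bar> - q\<close>, which leaves at least \<open>q\<close> for the denominator. The strong induction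
  carries the decay estimate itself, since it implies the smallness of all earlier entries.
\<close>

lemma geometric_decay:
  assumes k: "k \<ge> 1" and q: "q > 1" and \<eta>: "0 < \<eta>" "\<eta> \<le> 1" "\<bar>B\<bar> * \<eta> \<le> \<bar>A\<bar> - q"
    and sol: "is_solution k (rhs_dom k A B) (rhs k A B) u"
    and init: "\<And>j. j < 4 * k \<Longrightarrow> \<bar>u j\<bar> \<le> \<eta>"
  shows "\<bar>u n\<bar> \<le> \<eta> / q ^ (n div (4 * k))"
proof (induction n rule: less_induct)
  case (less n)
  show ?case
  proof (cases "n < 4 * k")
    case True
    then show ?thesis using init by simp
  next
    case False
    define m where "m = n - 4 * k"
    have n: "n = m + 4 * k" using False by (simp add: m_def)
    have small: "\<bar>u (m + 4 * r)\<bar> \<le> \<eta>" if "r < k" for r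
    proof -
      have "\<bar>u (m + 4 * r)\<bar> \<le> \<eta> / q ^ ((m + 4 * r) div (4 * k))"
        using less.IH that n by simp
      also have "\<dots> \<le> \<eta>"
        using q \<eta>(1) by (simp add: divide_le_eq mult_le_cancel_left1)
      finally show ?thesis .
    qed
    let ?w = "\<lambda>r. u (m + 4 * r)"
    have "\<bar>\<Prod>r<k. ?w r\<bar> \<le> (\<Prod>r<k. \<eta>)"
      unfolding abs_prod using small by (intro prod_mono) auto
    also have "\<dots> \<le> \<eta>"
      using power_decreasing[of 1 k \<eta>] k \<eta> by simp
    finally have "\<bar>B * (\<Prod>r<k. ?w r)\<bar> \<le> \<bar>B\<bar> * \<eta>"
      unfolding abs_mult by (intro mult_left_mono) auto
    then have denom: "q \<le> \<bar>denom k A B ?w\<bar>"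
      using \<eta>(3) unfolding denom_eq_prod_lessThan by linarith
    have "u n = u m / denom k A B ?w"
      using sol unfolding is_solution_def n rhs_def by simp
    then have "\<bar>u n\<bar> = \<bar>u m\<bar> / \<bar>denom k A B ?w\<bar>" by simp
    also have "\<dots> \<le> (\<eta> / q ^ (m div (4 * k))) / q"
      using less.IH[of m] n k q denom by (intro frac_le) auto
    also have "\<dots> = \<eta> / q ^ (n div (4 * k))"
      using k by (simp add: n mult.commute)
    finally show ?thesis .
  qed
qed

lemma zero_asymptotically_stable:
  assumes k: "k \<ge> 1" and A: "\<bar>A\<bar> > 1" and B: "B \<noteq> 0"
  shows "asymptotically_stable k (rhs_dom k A B) (rhs k A B) 0"
proof -
  define q where "q = (1 + \<bar>A\<bar>) / 2"
  define \<gamma> where "\<gamma> = min 1 ((\<bar>A\<bar> - q) / \<bar>B\<bar>)"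
  have q: "q > 1" "\<bar>A\<bar> - q > 0" using A by (auto simp: q_def)
  have \<gamma>: "\<gamma> > 0" "\<gamma> \<le> 1" using q B by (auto simp: \<gamma>_def)
  have decay: "\<bar>u n\<bar> \<le> \<eta> / q ^ (n div (4 * k))"
    if \<eta>: "0 < \<eta>" "\<eta> \<le> \<gamma>" and sol: "is_solution k (rhs_dom k A B) (rhs k A B) u"
      and init: "(\<Sum>j<4 * k. \<bar>u j\<bar>) < \<eta>" for \<eta> u n
  proof (rule geometric_decay[OF k q(1) \<eta>(1) _ _ sol])
    show "\<eta> \<le> 1" using \<eta> \<gamma> by simp
    have "\<eta> \<le> (\<bar>A\<bar> - q) / \<bar>B\<bar>" using \<eta> by (simp add: \<gamma>_def)
    then show "\<bar>B\<bar> * \<eta> \<le> \<bar>A\<bar> - q" using B by (simp add: field_simps)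
    show "\<bar>u j\<bar> \<le> \<eta>" if "j < 4 * k" for j
      using member_le_sum[of j "{..<4 * k}" "\<lambda>j. \<bar>u j\<bar>"] that init by simp
  qed
  have "\<exists>\<delta>>0. \<forall>u. is_solution k (rhs_dom k A B) (rhs k A B) u \<longrightarrow>
      (\<Sum>j<4 * k. \<bar>u j - 0\<bar>) < \<delta> \<longrightarrow> (\<forall>n. \<bar>u n - 0\<bar> < \<epsilon>)" if \<epsilon>: "\<epsilon> > 0" for \<epsilon>
  proof (intro exI[of _ "min (\<epsilon> / 2) \<gamma>"] conjI allI impI)
    show "min (\<epsilon> / 2) \<gamma> > 0" using \<epsilon> \<gamma> by simp
    fix u n
    assume "is_solution k (rhs_dom k A B) (rhs k A B) u"
      and "(\<Sum>j<4 * k. \<bar>u j - 0\<bar>) < min (\<epsilon> / 2) \<gamma>"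
    then have "\<bar>u n\<bar> \<le> min (\<epsilon> / 2) \<gamma> / q ^ (n div (4 * k))"
      using \<epsilon> \<gamma> by (intro decay) auto
    also have "\<dots> \<le> min (\<epsilon> / 2) \<gamma> / 1"
      using \<epsilon> \<gamma> q(1) by (intro divide_left_mono) auto
    also have "\<dots> < \<epsilon>" using \<epsilon> by auto
    finally show "\<bar>u n - 0\<bar> < \<epsilon>" by simp
  qed
  moreover have "u \<longlonglongrightarrow> 0"
    if "is_solution k (rhs_dom k A B) (rhs k A B) u" "(\<Sum>j<4 * k. \<bar>u j - 0\<bar>) < \<gamma>" for u
  proof (rule Lim_null_comparison)
    show "\<forall>\<^sub>F n in sequentially. norm (u n) \<le> \<gamma> / q ^ (n div (4 * k))"
      using decay[of \<gamma> u] that \<gamma> by simp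
    have "filterlim (\<lambda>n. n div (4 * k)) at_top sequentially"
      using k by (intro filterlim_at_top_div_const_nat) simp
    moreover have "(\<lambda>n. \<gamma> / q ^ n) \<longlonglongrightarrow> 0"
      using q(1) by (intro LIMSEQ_divide_realpow_zero)
    ultimately show "(\<lambda>n. \<gamma> / q ^ (n div (4 * k))) \<longlonglongrightarrow> 0"
      by (rule filterlim_compose[rotated])
  qed
  ultimately show ?thesis
    unfolding asymptotically_stable_def locally_stable_def using \<gamma>(1) by blast
qed

section \<open>Instability of the zero equilibrium\<close>

text \<open>
  The coefficient \<open>c\<close> accounts for both cases at once: two entries of a window at distance \<open>4\<close>
  cannot both have an index divisible by \<open>4k\<close> unless \<open>k = 1\<close>, so the product over the window is
  \<open>u n\<close> for \<open>k = 1\<close> and \<open>0\<close> otherwise.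
\<close>

lemma reciprocal_solution:
  fixes A B b t :: real
  assumes k: "k \<ge> 1" and A: "A \<noteq> 0"
    and c: "c = (if k = 1 then B else 0)" and b: "A * b + c = b"
    and nz: "\<And>m. b + A ^ m * t \<noteq> 0"
  defines "u \<equiv> \<lambda>n. if 4 * k dvd n then 1 / (b + A ^ (n div (4 * k)) * t) else 0"
  shows "is_solution k (rhs_dom k A B) (rhs k A B) u"
proof -
  have denom: "denom k A B (\<lambda>r. u (n + 4 * r)) = A + c * u n" for n
  proof (cases "k = 1")
    case True
    then show ?thesis by (simp add: denom_eq_prod_lessThan c)
  next
    case False
    with k have k2: "k \<ge> 2" by simp
    have "\<not> (4 * k dvd n \<and> 4 * k dvd n + 4)"
    proof
      assume "4 * k dvd n \<and> 4 * k dvd n + 4"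
      then have "4 * k dvd 4" using dvd_add_right_iff by blast
      then show False using k2 by (auto dest: dvd_imp_le)
    qed
    then have "u (n + 4 * 0) = 0 \<or> u (n + 4 * 1) = 0" by (auto simp: u_def)
    then have "(\<Prod>r<k. u (n + 4 * r)) = 0"
      using k2 by (intro prod_zero) (auto intro: bexI[of _ 0] bexI[of _ 1])
    then show ?thesis using False by (simp add: denom_eq_prod_lessThan c)
  qed
  have step: "A + c * u n \<noteq> 0 \<and> u (n + 4 * k) = u n / (A + c * u n)" for n
  proof (cases "4 * k dvd n")
    case True
    define v where "v = b + A ^ (n div (4 * k)) * t"
    define v' where "v' = b + A ^ Suc (n div (4 * k)) * t"
    have "v \<noteq> 0" "v' \<noteq> 0" using nz[of "n div (4 * k)"] nz[of "Suc (n div (4 * k))"]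
      by (simp_all add: v_def v'_def)
    have v': "v' = A * v + c" using b by (simp add: v_def v'_def algebra_simps)
    have "u n = 1 / v" "u (n + 4 * k) = 1 / v'"
      using True k by (simp_all add: u_def v_def v'_def)
    moreover have "A + c / v = v' / v" using \<open>v \<noteq> 0\<close> by (simp add: v' field_simps)
    ultimately show ?thesis using \<open>v \<noteq> 0\<close> \<open>v' \<noteq> 0\<close> by simp
  next
    case False
    then have "u n = 0" "u (n + 4 * k) = 0" by (simp_all add: u_def)
    then show ?thesis using A by simp
  qed
  show ?thesis
    unfolding is_solution_def rhs_dom_def rhs_def using step denom by simp
qed

lemma large_parameter_avoiding_zeros:
  fixes A b R :: real
  assumes "A \<noteq> 0"
  obtains t where "t > R" and "\<And>m :: nat. b + A ^ m * t \<noteq> 0"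
proof -
  have "uncountable {R<..<R + 1}"
    by (simp add: uncountable_open_interval)
  then have "\<not> {R<..<R + 1} \<subseteq> range (\<lambda>m :: nat. - b / A ^ m)"
    by (meson countable_subset countableI_type countable_image)
  then obtain t where t: "t > R" "t \<notin> range (\<lambda>m :: nat. - b / A ^ m)"
    by (metis greaterThanLessThan_iff subsetI)
  have "b + A ^ m * t \<noteq> 0" for m :: nat
  proof
    assume "b + A ^ m * t = 0"
    then have "t = - b / A ^ m" using assms by (simp add: field_simps)
    then show False using t by blast
  qed
  with t(1) show thesis by (rule that)
qed

lemma zero_unstable:
  assumes k: "k \<ge> 1" and A: "A \<noteq> 0" "\<bar>A\<bar> < 1"
  shows "unstable k (rhs_dom k A B) (rhs k A B) 0"
  unfolding unstable_def
proof
  define c where "c = (if k = 1 then B else 0)"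
  define b where "b = c / (1 - A)"
  have b: "A * b + c = b" using A by (simp add: b_def field_simps)
  assume "locally_stable k (rhs_dom k A B) (rhs k A B) 0"
  \<comment> \<open>The reciprocals come within distance \<open>1\<close> of \<open>b\<close>, so \<open>u\<close> reaches this \<open>\<epsilon>\<close>.\<close>
  moreover have "1 / (\<bar>b\<bar> + 1) > 0" by (simp add: add_nonneg_pos)
  ultimately obtain \<delta> where \<delta>: "\<delta> > 0" and
    stable: "\<And>u n. is_solution k (rhs_dom k A B) (rhs k A B) u \<Longrightarrow> (\<Sum>j<4 * k. \<bar>u j - 0\<bar>) < \<delta>
      \<Longrightarrow> \<bar>u n - 0\<bar> < 1 / (\<bar>b\<bar> + 1)"
    unfolding locally_stable_def by meson
  obtain t where t: "t > \<bar>b\<bar> + 1 / \<delta>" and nz: "\<And>m. b + A ^ m * t \<noteq> 0"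
    using large_parameter_avoiding_zeros[OF A(1)] by metis
  define u where "u = (\<lambda>n. if 4 * k dvd n then 1 / (b + A ^ (n div (4 * k)) * t) else 0)"
  have sol: "is_solution k (rhs_dom k A B) (rhs k A B) u"
    unfolding u_def by (rule reciprocal_solution[OF k A(1) c_def b nz])
  have "(\<Sum>j<4 * k. \<bar>u j - 0\<bar>) = (\<Sum>j<4 * k. if j = 0 then \<bar>u 0\<bar> else 0)"
    by (intro sum.cong) (auto simp: u_def dest: dvd_imp_le)
  also have "\<dots> = 1 / \<bar>b + t\<bar>"
    using k by (simp add: u_def)
  also have "\<dots> < \<delta>"
  proof -
    have "1 / \<delta> < \<bar>b + t\<bar>" using t by linarith
    moreover have "0 < 1 / \<delta>" using \<delta> by simp
    ultimately show ?thesis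
      using \<delta> by (metis divide_strict_left_mono inverse_eq_divide inverse_inverse_eq
          inverse_less_iff_less less_trans)
  qed
  finally have bound: "\<bar>u n\<bar> < 1 / (\<bar>b\<bar> + 1)" for n using stable[OF sol] by simp
  have "(\<lambda>m. A ^ m * t) \<longlonglongrightarrow> 0 * t"
    using A by (intro tendsto_intros LIMSEQ_power_zero) simp
  then have "\<forall>\<^sub>F m in sequentially. dist (A ^ m * t) 0 < 1"
    by (auto dest: tendstoD[where e = 1])
  then obtain m where m: "\<bar>A ^ m * t\<bar> < 1" by (auto simp: eventually_sequentially)
  have "\<bar>u (4 * k * m)\<bar> = 1 / \<bar>b + A ^ m * t\<bar>" using k by (simp add: u_def)
  also have "\<dots> \<ge> 1 / (\<bar>b\<bar> + 1)"
    using m nz[of m] by (intro divide_left_mono mult_pos_pos) auto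
  finally show False using bound[of "4 * k * m"] by simp
qed

section \<open>Non-hyperbolicity of the non-zero equilibria\<close>

lemma nonzero_equilibrium_power:
  assumes "is_equilibrium (rhs_dom k A B) (rhs k A B) ubar" "ubar \<noteq> 0"
  shows "B * ubar ^ k = 1 - A"
proof -
  have "A + B * ubar ^ k \<noteq> 0" "ubar = ubar / (A + B * ubar ^ k)"
    using assms(1)
    by (simp_all add: is_equilibrium_def rhs_dom_def rhs_def denom_eq_prod_lessThan)
  then have "ubar * (A + B * ubar ^ k) = ubar * 1"
    by (simp add: eq_divide_eq)
  then have "A + B * ubar ^ k = 1"
    using assms(2) mult_left_cancel by blast
  then show ?thesis by simp
qed

lemma lin_coeff_rhs:
  assumes r: "r < k" and eq: "B * ubar ^ k = 1 - A"
  shows "lin_coeff (rhs k A B) ubar r = (if r = 0 then A else A - 1)"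
proof -
  define a where "a = B * ubar ^ (k - 1)"
  have a: "a * ubar = 1 - A"
    using eq r by (simp add: a_def mult.assoc power_Suc2[symmetric] del: power_Suc)
  have prod: "(\<Prod>i<k. ((\<lambda>_. ubar)(r := x)) i) = x * ubar ^ (k - 1)" for x
  proof -
    have "(\<Prod>i<k. ((\<lambda>_. ubar)(r := x)) i) = x * (\<Prod>i\<in>{..<k} - {r}. ((\<lambda>_. ubar)(r := x)) i)"
      using r by (subst prod.remove[of _ r]) auto
    also have "(\<Prod>i\<in>{..<k} - {r}. ((\<lambda>_. ubar)(r := x)) i) = (\<Prod>i\<in>{..<k} - {r}. ubar)"
      by (intro prod.cong) auto
    finally show ?thesis using r by simp
  qed
  have rhs: "rhs k A B ((\<lambda>_. ubar)(r := x)) = (if r = 0 then x else ubar) / (A + a * x)" for x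
    unfolding rhs_def denom_eq_prod_lessThan prod by (simp add: a_def mult_ac)
  have one: "A + a * ubar = 1" using a by simp
  show ?thesis
  proof (cases "r = 0")
    case True
    have "((\<lambda>x. x / (A + a * x)) has_real_derivative A) (at ubar)"
      using one by (auto intro!: derivative_eq_intros simp: algebra_simps)
    then show ?thesis
      unfolding lin_coeff_def rhs using True by (simp add: DERIV_imp_deriv)
  next
    case False
    have "((\<lambda>x. ubar / (A + a * x)) has_real_derivative A - 1) (at ubar)"
      using one a by (auto intro!: derivative_eq_intros simp: algebra_simps)
    then show ?thesis
      unfolding lin_coeff_def rhs using False by (simp add: DERIV_imp_deriv)
  qed
qed

text \<open>
  With \<open>S\<close> the geometric sum, \<open>\<mu> ^ k - 1 = (\<mu> - 1) * S\<close>, and the lower-order terms contribute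
  \<open>1 + (A - 1) * S\<close>.
\<close>

lemma characteristic_factorization:
  fixes \<mu> A :: "'a :: comm_ring_1"
  assumes "k \<ge> 1"
  shows "\<mu> ^ k - (\<Sum>r<k. (if r = 0 then A else A - 1) * \<mu> ^ r) = (\<mu> - A) * (\<Sum>r<k. \<mu> ^ r)"
proof -
  have "(\<Sum>r<k. (if r = 0 then A else A - 1) * \<mu> ^ r)
      = (\<Sum>r<k. (if r = 0 then 1 else 0) + (A - 1) * \<mu> ^ r)"
    by (intro sum.cong) auto
  also have "\<dots> = 1 + (A - 1) * (\<Sum>r<k. \<mu> ^ r)"
    using assms by (simp add: sum.distrib sum_distrib_left)
  finally have lower: "(\<Sum>r<k. (if r = 0 then A else A - 1) * \<mu> ^ r)
      = 1 + (A - 1) * (\<Sum>r<k. \<mu> ^ r)" .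
  have "\<mu> ^ k - 1 = (\<mu> - 1) * (\<Sum>r<k. \<mu> ^ r)"
    by (rule power_diff_1_eq)
  then show ?thesis unfolding lower by (simp add: algebra_simps)
qed

lemma nonzero_equilibrium_non_hyperbolic:
  assumes k: "k \<ge> 2 \<or> k = 1 \<and> \<bar>A\<bar> = 1"
    and eq: "is_equilibrium (rhs_dom k A B) (rhs k A B) ubar" "ubar \<noteq> 0"
  shows "non_hyperbolic k (rhs k A B) ubar"
proof -
  have k1: "k \<ge> 1" using k by auto
  have char: "z ^ (4 * k) - (\<Sum>r<k. of_real (lin_coeff (rhs k A B) ubar r) * z ^ (4 * r))
      = (z ^ 4 - of_real A) * (\<Sum>r<k. (z ^ 4) ^ r)" for z :: complex
  proof -
    have "(\<Sum>r<k. of_real (lin_coeff (rhs k A B) ubar r) * z ^ (4 * r))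
        = (\<Sum>r<k. (if r = 0 then of_real A else of_real A - 1) * (z ^ 4) ^ r)"
      using lin_coeff_rhs[OF _ nonzero_equilibrium_power[OF eq]]
      by (intro sum.cong) (auto simp: power_mult)
    then show ?thesis
      using characteristic_factorization[OF k1, of "z ^ 4" "of_real A"] by (simp add: power_mult)
  qed
  have "\<exists>z. (z ^ 4 = of_real A \<or> (\<Sum>r<k. (z ^ 4) ^ r) = 0) \<and> cmod z = 1"
  proof (cases "k \<ge> 2")
    case True
    define z where "z = cis (2 * pi / k / 4)"
    have z4: "z ^ 4 = cis (2 * pi / k)" by (simp add: z_def Complex.DeMoivre)
    have "z ^ 4 \<noteq> 1"
    proof
      assume "z ^ 4 = 1"
      then have "cos (2 * pi / k) = 1" by (simp add: z4 complex_eq_iff)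
      moreover have "cos (2 * pi / k) < cos 0"
        using True by (intro cos_monotone_0_pi) (auto simp: field_simps)
      ultimately show False by simp
    qed
    moreover have "(z ^ 4) ^ k = 1" unfolding z4 Complex.DeMoivre using True by simp
    ultimately have "(\<Sum>r<k. (z ^ 4) ^ r) = 0" by (simp add: geometric_sum)
    moreover have "cmod z = 1" by (simp add: z_def)
    ultimately show ?thesis by blast
  next
    case False
    with k have A: "\<bar>A\<bar> = 1" by auto
    \<comment> \<open>A fourth root of \<open>A\<close>, which is \<open>1\<close> or \<open>- 1\<close>.\<close>
    define z where "z = (if A = 1 then 1 else cis (pi / 4))"
    have "z ^ 4 = of_real A"
      using A by (auto simp: z_def Complex.DeMoivre abs_if split: if_splits)
    moreover have "cmod z = 1" by (simp add: z_def)
    ultimately show ?thesis by blast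
  qed
  then show ?thesis unfolding non_hyperbolic_def char by auto
qed

section \<open>Classification of the equilibria\<close>

theorem theorem4p4:
  fixes k :: nat and A B :: real
  assumes "k \<ge> 1" and "A \<noteq> 0" and "B \<noteq> 0" and "A \<noteq> 1"
  shows "is_equilibrium (rhs_dom k A B) (rhs k A B) 0
    \<and> (\<bar>A\<bar> > 1 \<longrightarrow> asymptotically_stable k (rhs_dom k A B) (rhs k A B) 0)
    \<and> (\<bar>A\<bar> < 1 \<longrightarrow> unstable k (rhs_dom k A B) (rhs k A B) 0)
    \<and> (k \<ge> 2 \<or> \<bar>A\<bar> = 1 \<longrightarrow>
         (\<forall>ubar. is_equilibrium (rhs_dom k A B) (rhs k A B) ubar \<and> ubar \<noteq> 0 \<longrightarrow>
            non_hyperbolic k (rhs k A B) ubar))"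
proof (intro conjI impI allI)
  show "is_equilibrium (rhs_dom k A B) (rhs k A B) 0"
    using assms
    by (simp add: is_equilibrium_def rhs_dom_def rhs_def denom_eq_prod_lessThan power_0_left)
  show "asymptotically_stable k (rhs_dom k A B) (rhs k A B) 0" if "\<bar>A\<bar> > 1"
    using zero_asymptotically_stable assms that by blast
  show "unstable k (rhs_dom k A B) (rhs k A B) 0" if "\<bar>A\<bar> < 1"
    using zero_unstable assms that by blast
  show "non_hyperbolic k (rhs k A B) ubar"
    if "k \<ge> 2 \<or> \<bar>A\<bar> = 1"
      and "is_equilibrium (rhs_dom k A B) (rhs k A B) ubar \<and> ubar \<noteq> 0" for ubar
    using nonzero_equilibrium_non_hyperbolic[of k A B ubar] that \<open>k \<ge> 1\<close> by linarith
qed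

end
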